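(* Let $N\ge1$, let $k,m\ge0$ be integers, let $M_{-k},\dots,M_m\in\mathbb{C}^{N\times N}$, and let $$S(t)=\sum_{j=-k}^mM_jt^{k+j},\qquad A(t)=t^{-k}S(t)=\sum_{j=-k}^{m}M_jt^j.$$ If $S$ is of type $(s,0,\ell)$ with $s\ne kN$, then there exist constants $c>0$ and $\alpha>0$ such that $\kappa(T_n(A))\ge c\,e^{\alpha n}$ for all $n\ge 1$.
   Context: The matrix polynomial $S$ is said to be of type $(s,u,\ell)$ if $\det S$ (not identically zero) has $s$ zeros of modulus smaller than $1$, $u$ zeros of modulus $1$, and $\ell$ zeros of modulus larger than $1$, counted with multiplicity. $T_n(A)=(M_{i-j})_{i,j=0}^{n-1}\in\mathbb{C}^{nN\times nN}$ is the block Toeplitz band matrix with $M_j$ on the $j$th block diagonal ($j>0$ subdiagonals, $j<0$ superdiagonals; $M_j:=0$ outside $-k\le j\le m$). $\kappa(M)=\|M\|\,\|M^{-1}\|$ with the spectral norm, and $\kappa(M)=\infty$ if $M$ is not invertible. *)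

theory Defs
  imports
    "HOL-Analysis.L2_Norm"
    "HOL-Library.Extended_Real"
    "HOL-Computational_Algebra.Polynomial"
    "Jordan_Normal_Form.Determinant"
    "Jordan_Normal_Form.Gauss_Jordan_Elimination"
begin

text \<open>The family \<open>M\<close> is indexed by \<^typ>\<open>int\<close>, but only \<open>M j\<close> with \<open>- k \<le> j \<le> m\<close> is ever used;
  the truncation \<open>band_coeff\<close> implements the convention that \<open>M j\<close> is zero otherwise.\<close>

definition matrix_poly :: "nat \<Rightarrow> nat \<Rightarrow> nat \<Rightarrow> (int \<Rightarrow> complex mat) \<Rightarrow> complex poly mat" where
  "matrix_poly N k m M =
     mat N N (\<lambda>(p, q). \<Sum>j\<in>{- int k..int m}. Polynomial.monom (M j $$ (p, q)) (nat (int k + j)))"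

definition matrix_poly_type :: "complex poly mat \<Rightarrow> nat \<Rightarrow> nat \<Rightarrow> nat \<Rightarrow> bool" where
  "matrix_poly_type S s u l \<longleftrightarrow>
     det S \<noteq> 0 \<and>
     size {#z \<in># proots (det S). cmod z < 1#} = s \<and>
     size {#z \<in># proots (det S). cmod z = 1#} = u \<and>
     size {#z \<in># proots (det S). cmod z > 1#} = l"

definition band_coeff :: "nat \<Rightarrow> nat \<Rightarrow> nat \<Rightarrow> (int \<Rightarrow> complex mat) \<Rightarrow> int \<Rightarrow> complex mat" where
  "band_coeff N k m M j = (if - int k \<le> j \<and> j \<le> int m then M j else 0\<^sub>m N N)"

text \<open>The scalar index \<open>p < n * N\<close> is entry \<open>p mod N\<close> of block \<open>p div N\<close>.\<close>

definition block_toeplitz :: "nat \<Rightarrow> nat \<Rightarrow> (int \<Rightarrow> complex mat) \<Rightarrow> complex mat" where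
  "block_toeplitz N n a =
     mat (n * N) (n * N) (\<lambda>(p, q). a (int (p div N) - int (q div N)) $$ (p mod N, q mod N))"

definition euclidean_norm :: "complex vec \<Rightarrow> real" where
  "euclidean_norm v = L2_set (\<lambda>i. cmod (v $ i)) {..<dim_vec v}"

definition spectral_norm :: "complex mat \<Rightarrow> real" where
  "spectral_norm A =
     (SUP v\<in>{v \<in> carrier_vec (dim_col A). euclidean_norm v \<le> 1}. euclidean_norm (A *\<^sub>v v))"

text \<open>The supremum of real numbers is meaningful only because the set is bounded and nonempty.\<close>

lemma bdd_above_spectral_norm:
  "bdd_above ((\<lambda>v. euclidean_norm (A *\<^sub>v v)) ` {v \<in> carrier_vec (dim_col A). euclidean_norm v \<le> 1})"
proof (rule bdd_aboveI2)
  fix v assume "v \<in> {v \<in> carrier_vec (dim_col A). euclidean_norm v \<le> 1}"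
  then have v: "dim_vec v = dim_col A" "euclidean_norm v \<le> 1" by auto
  have le1: "cmod (v $ j) \<le> 1" if "j < dim_col A" for j
    using member_le_L2_set[of "{..<dim_vec v}" j "\<lambda>i. cmod (v $ i)"] that v
    by (simp add: euclidean_norm_def)
  have "euclidean_norm (A *\<^sub>v v) \<le> (\<Sum>i<dim_row A. cmod ((A *\<^sub>v v) $ i))"
    unfolding euclidean_norm_def dim_mult_mat_vec by (rule L2_set_le_sum) simp
  also have "\<dots> \<le> (\<Sum>i<dim_row A. \<Sum>j<dim_col A. cmod (A $$ (i, j)))"
  proof (rule sum_mono)
    fix i assume "i \<in> {..<dim_row A}"
    then have "cmod ((A *\<^sub>v v) $ i) = cmod (\<Sum>j<dim_col A. A $$ (i, j) * v $ j)"
      by (simp add: scalar_prod_def v atLeast0LessThan)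
    also have "\<dots> \<le> (\<Sum>j<dim_col A. cmod (A $$ (i, j)) * cmod (v $ j))"
      by (rule sum_norm_le) (simp add: norm_mult)
    also have "\<dots> \<le> (\<Sum>j<dim_col A. cmod (A $$ (i, j)))"
      by (rule sum_mono) (simp add: le1 mult_left_le)
    finally show "cmod ((A *\<^sub>v v) $ i) \<le> (\<Sum>j<dim_col A. cmod (A $$ (i, j)))" .
  qed
  finally show "euclidean_norm (A *\<^sub>v v) \<le> (\<Sum>i<dim_row A. \<Sum>j<dim_col A. cmod (A $$ (i, j)))" .
qed

lemma spectral_norm_nonempty: "{v \<in> carrier_vec n. euclidean_norm v \<le> 1} \<noteq> {}"
proof -
  have "0\<^sub>v n \<in> {v \<in> carrier_vec n. euclidean_norm v \<le> 1}"
    by (simp add: euclidean_norm_def L2_set_def)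
  then show ?thesis by blast
qed

definition condition_number :: "complex mat \<Rightarrow> ereal" where
  "condition_number A =
     (case mat_inverse A of
        None \<Rightarrow> \<infinity>
      | Some B \<Rightarrow> ereal (spectral_norm A * spectral_norm B))"

end

theory Submission
  imports
    Defs
    "HOL-Analysis.FPS_Convergence"
    "HOL-Computational_Algebra.Fundamental_Theorem_Algebra"
begin

text \<open>
  For large \<open>n\<close> the matrices share a nonzero entry, so their norms stay away from zero, and it is enough
  to find vectors of norm bounded below which \<open>T\<^sub>n(A)\<close> maps to vectors of norm \<open>O(n r\<^sup>n)\<close> with \<open>r < 1\<close>
  (\<open>condition_number_exponential\<close>).

  Suppose first that \<open>s < k N\<close>.  Let \<open>x\<close> be a vector of power series with radius of convergence greater
  than 1 such that \<open>S x = f\<close> is a nonzero polynomial vector of degree less than \<open>k\<close>.  Its coefficients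
  \<open>x\<^sub>0, x\<^sub>1, \<dots>\<close> decay geometrically and satisfy \<open>\<Sum>\<^sub>j M\<^bsub>i - j\<^esub> x\<^sub>j = 0\<close> for all \<open>i \<ge> 0\<close>, so the first \<open>n\<close> of
  them form the desired vector: only the discarded tail contributes to the residual.  Such an \<open>x\<close>
  exists by counting.  Solving for \<open>x = S\<^sup>-\<^sup>1 f\<close> without poles in the disc imposes one scalar linear
  condition on \<open>f\<close> for each of the \<open>s\<close> zeros of \<open>det S\<close> there (\<open>disc_solvable_combination\<close>), while \<open>f\<close>
  ranges over a space of dimension \<open>k N\<close>.  The zeros are removed one at a time by row operations,
  which handles multiplicities without Jordan chains or the Smith normal form.

  If \<open>s > k N\<close>, reverse the order of the blocks.  This replaces \<open>A(t)\<close> by \<open>A(1 / t)\<close>, exchanges \<open>k\<close> and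
  \<open>m\<close>, and leaves \<open>(k + m) N - s < m N\<close> zeros in the disc (\<open>quasimodes_if_nonzero_index\<close>), so the first
  case applies.
\<close>

(* Leaves the dollar sign to the vectors and matrices of variable dimension. *)
unbundle no vec_syntax

section \<open>Polynomials that are invertible on the closed unit disc\<close>

text \<open>For a polynomial this is the same as having no zeros in the closed unit disc.  The inverse is kept
  as a formal power series because only its coefficients matter: radius of convergence above 1 makes
  them decay geometrically.\<close>
definition disc_unit :: "complex poly \<Rightarrow> bool" where
  "disc_unit q \<longleftrightarrow> (\<exists>g. 1 < fps_conv_radius g \<and> fps_of_poly q * g = 1)"

lemma disc_unit_mult:
  assumes "disc_unit p" "disc_unit q"
  shows "disc_unit (p * q)"
proof -
  obtain f g where f: "1 < fps_conv_radius f" "fps_of_poly p * f = 1"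
    and g: "1 < fps_conv_radius g" "fps_of_poly q * g = 1"
    using assms unfolding disc_unit_def by blast
  have "1 < fps_conv_radius (f * g)"
    using fps_conv_radius_mult[of f g] f(1) g(1) by (auto simp: min_def split: if_splits)
  moreover have "fps_of_poly (p * q) * (f * g) = (fps_of_poly p * f) * (fps_of_poly q * g)"
    by (simp only: fps_of_poly_mult mult_ac)
  ultimately show ?thesis unfolding disc_unit_def using f(2) g(2) by auto
qed

text \<open>The inverse of \<open>a + b t\<close> is a geometric series of ratio \<open>- b t / a\<close>.\<close>
lemma disc_unit_linear:
  assumes "cmod b < cmod a"
  shows "disc_unit [:a, b:]"
proof -
  define \<rho> where "\<rho> = cmod (b / a)"
  have a: "a \<noteq> 0" using assms by auto
  have \<rho>: "0 \<le> \<rho>" "\<rho> < 1" using assms a by (auto simp: \<rho>_def norm_divide)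
  define g where "g = Abs_fps (\<lambda>n. inverse a * (- b / a) ^ n)"
  \<comment> \<open>The radius is \<open>1 / \<rho>\<close>; the number \<open>2 / (1 + \<rho>)\<close> lies strictly between 1 and it and also
    makes sense for \<open>\<rho> = 0\<close>.\<close>
  have "ereal (2 / (1 + \<rho>)) \<le> fps_conv_radius g" unfolding fps_conv_radius_def
  proof (rule conv_radius_geI_ex')
    fix r :: real assume r: "0 < r" "ereal r < ereal (2 / (1 + \<rho>))"
    have "cmod (- b / a * of_real r) = \<rho> * r" using r by (simp add: \<rho>_def norm_mult norm_divide)
    also have "\<dots> \<le> \<rho> * (2 / (1 + \<rho>))" using r \<rho> by (intro mult_left_mono) auto
    also have "\<dots> < 1" using \<rho> by (simp add: field_simps)
    finally have "summable (\<lambda>n. inverse a * (- b / a * of_real r) ^ n)"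
      by (intro summable_mult summable_geometric)
    then show "summable (\<lambda>n. fps_nth g n * of_real r ^ n)"
      unfolding g_def power_mult_distrib by (simp only: fps_nth_Abs_fps mult.assoc)
  qed
  moreover have "1 < ereal (2 / (1 + \<rho>))" using \<rho> by (simp add: field_simps)
  ultimately have "1 < fps_conv_radius g" by (meson less_le_trans)
  moreover have "fps_of_poly [:a, b:] * g = 1"
  proof (rule fps_ext)
    fix n
    have "fps_of_poly [:a, b:] * g = fps_const a * g + fps_const b * (fps_X * g)"
      by (simp add: fps_of_poly_pCons algebra_simps)
    then show "fps_nth (fps_of_poly [:a, b:] * g) n = fps_nth 1 n"
      using a by (cases n) (auto simp: g_def field_simps)
  qed
  ultimately show ?thesis unfolding disc_unit_def by blast
qed

lemma disc_unit_const: "c \<noteq> 0 \<Longrightarrow> disc_unit [:c:]"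
  using disc_unit_linear[of 0 c] by simp

lemma disc_unit_prod_mset: "(\<And>z. z \<in># Z \<Longrightarrow> disc_unit (f z)) \<Longrightarrow> disc_unit (\<Prod>z\<in>#Z. f z)"
  by (induction Z) (auto simp: disc_unit_mult disc_unit_const[of 1, folded one_pCons, simplified])

section \<open>Solving linear systems over the closed unit disc\<close>

lemma smult_sum_right: "smult c (sum f A) = (\<Sum>i\<in>A. smult c (f i))"
  by (induction A rule: infinite_finite_induct) (simp_all add: smult_add_right)

definition disc_solvable :: "nat \<Rightarrow> complex poly mat \<Rightarrow> (nat \<Rightarrow> complex poly) \<Rightarrow> bool" where
  "disc_solvable N S p \<longleftrightarrow> (\<exists>x. (\<forall>j<N. 1 < fps_conv_radius (x j)) \<and>
     (\<forall>i<N. (\<Sum>j<N. fps_of_poly (S $$ (i, j)) * x j) = fps_of_poly (p i)))"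

text \<open>Expand both determinants along row \<open>a\<close>: the cofactors agree, and a row \<open>b \<noteq> a\<close> of \<open>S\<close> paired with
  the cofactors of row \<open>a\<close> gives zero.\<close>
lemma det_row_combination:
  fixes S T :: "'a :: comm_ring_1 mat"
  assumes S: "S \<in> carrier_mat N N" and T: "T \<in> carrier_mat N N" and a: "a < N"
    and other: "\<And>b j. b < N \<Longrightarrow> b \<noteq> a \<Longrightarrow> j < N \<Longrightarrow> T $$ (b, j) = S $$ (b, j)"
    and comb: "\<And>j. j < N \<Longrightarrow> f * T $$ (a, j) = (\<Sum>b<N. w b * S $$ (b, j))"
  shows "f * det T = w a * det S"
proof -
  have del: "mat_delete T a j = mat_delete S a j" if "j < N" for j
    using S T a that by (intro eq_matI) (auto simp: mat_delete_def intro!: other)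
  have prod: "(\<Sum>j<N. S $$ (b, j) * cofactor S a j) = (if b = a then det S else 0)" if "b < N" for b
  proof -
    have "(\<Sum>j<N. S $$ (b, j) * cofactor S a j) = (S * adj_mat S) $$ (b, a)"
      using S a that adj_mat(1)[OF S]
      by (simp add: adj_mat_def scalar_prod_def atLeast0LessThan)
    also have "\<dots> = (if b = a then det S else 0)"
      using a that by (simp add: adj_mat(2)[OF S])
    finally show ?thesis .
  qed
  have "f * det T = (\<Sum>j<N. (\<Sum>b<N. w b * S $$ (b, j)) * cofactor S a j)"
    unfolding laplace_expansion_row[OF T a] sum_distrib_left
    by (intro sum.cong refl) (simp add: cofactor_def del comb[symmetric] mult.assoc)
  also have "\<dots> = (\<Sum>b<N. w b * (\<Sum>j<N. S $$ (b, j) * cofactor S a j))"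
    unfolding sum_distrib_right sum_distrib_left by (subst sum.swap) (simp add: mult.assoc)
  also have "\<dots> = (\<Sum>b<N. if b = a then w a * det S else 0)"
    by (intro sum.cong refl) (simp add: prod)
  also have "\<dots> = w a * det S"
    using a by simp
  finally show ?thesis .
qed

lemma left_null_vector:
  assumes S: "S \<in> carrier_mat N N" and root: "poly (det S) (z :: complex) = 0"
  obtains a w where "a < N" "w a \<noteq> 0" "\<And>j. j < N \<Longrightarrow> (\<Sum>b<N. w b * poly (S $$ (b, j)) z) = 0"
proof -
  interpret ev: comm_ring_hom "\<lambda>p. poly p z" by unfold_locales auto
  let ?A = "(map_mat (\<lambda>p. poly p z) S)\<^sup>T"
  have A: "?A \<in> carrier_mat N N" using S by simp
  have "det ?A = 0"
    using root det_transpose[of "map_mat (\<lambda>p. poly p z) S" N] S by simp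
  then obtain v where v: "v \<in> carrier_vec N" "v \<noteq> 0\<^sub>v N" "?A *\<^sub>v v = 0\<^sub>v N"
    using det_0_iff_vec_prod_zero[OF A] by auto
  obtain a where a: "a < N" "v $ a \<noteq> 0"
    using v(1,2) by (metis carrier_vecD eq_vecI index_zero_vec)
  have "(\<Sum>b<N. v $ b * poly (S $$ (b, j)) z) = 0" if "j < N" for j
  proof -
    have "(?A *\<^sub>v v) $ j = 0" using v(3) that by simp
    then show ?thesis
      using that S v(1) by (simp add: scalar_prod_def atLeast0LessThan mult.commute)
  qed
  with a that show ?thesis by blast
qed

text \<open>Cramer's rule: \<open>x = adj S p / det S\<close>.\<close>
lemma disc_solvable_det_unit:
  assumes S: "S \<in> carrier_mat N N"
    and unit: "disc_unit (det S)"
  shows "disc_solvable N S p"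
proof -
  obtain g where g: "1 < fps_conv_radius g" "fps_of_poly (det S) * g = 1"
    using unit unfolding disc_unit_def by blast
  define x where "x j = (\<Sum>i<N. fps_of_poly (adj_mat S $$ (j, i) * p i) * g)" for j
  have radius: "1 < fps_conv_radius (x j)" for j
  proof -
    have "fps_conv_radius (f * g) > 1" if "fps_conv_radius f > 1" for f
      using fps_conv_radius_mult[of f g] that g(1) by (auto simp: min_def split: if_splits)
    moreover have "x j = fps_of_poly (\<Sum>i<N. adj_mat S $$ (j, i) * p i) * g"
      by (simp add: x_def fps_of_poly_sum sum_distrib_right)
    ultimately show ?thesis by simp
  qed
  have "(\<Sum>j<N. fps_of_poly (S $$ (i, j)) * x j) = fps_of_poly (p i)" if i: "i < N" for i
  proof -
    have "(\<Sum>j<N. S $$ (i, j) * (\<Sum>b<N. adj_mat S $$ (j, b) * p b))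
        = (\<Sum>b<N. (\<Sum>j<N. S $$ (i, j) * adj_mat S $$ (j, b)) * p b)"
      unfolding sum_distrib_right sum_distrib_left by (subst sum.swap) (simp add: mult.assoc)
    also have "\<dots> = (\<Sum>b<N. (S * adj_mat S) $$ (i, b) * p b)"
      using S i adj_mat(1)[OF S] by (intro sum.cong refl) (simp add: scalar_prod_def atLeast0LessThan)
    also have "\<dots> = (\<Sum>b<N. if b = i then det S * p i else 0)"
      using i by (intro sum.cong refl) (auto simp: adj_mat(2)[OF S])
    also have "\<dots> = det S * p i" using i by simp
    finally have *: "(\<Sum>j<N. S $$ (i, j) * (\<Sum>b<N. adj_mat S $$ (j, b) * p b)) = det S * p i" .
    have "(\<Sum>j<N. fps_of_poly (S $$ (i, j)) * x j)
        = fps_of_poly (\<Sum>j<N. S $$ (i, j) * (\<Sum>b<N. adj_mat S $$ (j, b) * p b)) * g"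
      by (simp add: x_def fps_of_poly_sum fps_of_poly_mult sum_distrib_right mult.assoc flip: sum_distrib_left)
    also have "\<dots> = fps_of_poly (p i) * (fps_of_poly (det S) * g)"
      unfolding * by (simp add: fps_of_poly_mult mult_ac)
    finally show ?thesis using g(2) by simp
  qed
  with radius show ?thesis unfolding disc_solvable_def by blast
qed

text \<open>Row \<open>a\<close> of \<open>T x = p'\<close>, multiplied by \<open>f\<close>, is the \<open>w\<close>-combination of the rows of \<open>S x = p\<close>, all of
  which except row \<open>a\<close> already hold.  Cancelling \<open>w a\<close> recovers row \<open>a\<close>.\<close>
lemma disc_solvable_row_combination:
  assumes a: "a < N" "w a \<noteq> 0"
    and comb: "\<And>j. j < N \<Longrightarrow> f * T $$ (a, j) = (\<Sum>b<N. smult (w b) (S $$ (b, j)))"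
    and other: "\<And>b j. b < N \<Longrightarrow> b \<noteq> a \<Longrightarrow> j < N \<Longrightarrow> T $$ (b, j) = S $$ (b, j)"
    and p': "f * p' a = (\<Sum>b<N. smult (w b) (p b))" "\<And>b. b < N \<Longrightarrow> b \<noteq> a \<Longrightarrow> p' b = p b"
    and sol: "disc_solvable N T p'"
  shows "disc_solvable N S p"
proof -
  obtain x where rad: "\<And>j. j < N \<Longrightarrow> 1 < fps_conv_radius (x j)"
    and x: "\<And>i. i < N \<Longrightarrow> (\<Sum>j<N. fps_of_poly (T $$ (i, j)) * x j) = fps_of_poly (p' i)"
    using sol unfolding disc_solvable_def by blast
  define r where "r b = (\<Sum>j<N. fps_of_poly (S $$ (b, j)) * x j) - fps_of_poly (p b)" for b
  have r0: "r b = 0" if "b < N" "b \<noteq> a" for b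
    using x[OF that(1)] that by (simp add: r_def other p'(2))
  have "(\<Sum>b<N. fps_const (w b) * r b)
      = (\<Sum>j<N. fps_of_poly (\<Sum>b<N. smult (w b) (S $$ (b, j))) * x j)
        - fps_of_poly (\<Sum>b<N. smult (w b) (p b))"
    unfolding r_def right_diff_distrib sum_subtractf sum_distrib_left fps_of_poly_sum sum_distrib_right
    by (subst sum.swap) (simp add: fps_of_poly_smult mult.assoc)
  also have "\<dots> = fps_of_poly f * ((\<Sum>j<N. fps_of_poly (T $$ (a, j)) * x j) - fps_of_poly (p' a))"
    by (simp add: comb[symmetric] p'(1)[symmetric] fps_of_poly_mult right_diff_distrib sum_distrib_left mult.assoc)
  also have "\<dots> = 0" using x[OF a(1)] by simp
  finally have "(\<Sum>b<N. fps_const (w b) * r b) = 0" .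
  moreover have "(\<Sum>b<N. fps_const (w b) * r b) = (\<Sum>b<N. if b = a then fps_const (w a) * r a else 0)"
    by (intro sum.cong refl) (auto simp: r0)
  ultimately have "r a = 0" using a by simp
  with r0 have "r b = 0" if "b < N" for b using that by (cases "b = a") auto
  then show ?thesis unfolding disc_solvable_def r_def using rad by auto
qed

text \<open>Each zero of \<open>det S\<close> costs only one linear condition on the right-hand side.  Indeed, if
  \<open>det S\<close> vanishes at \<open>z\<close>, some nonzero row vector \<open>w\<close> annihilates \<open>S(z)\<close>, so the \<open>w\<close>-combination of the
  rows of \<open>S\<close> can be divided by \<open>t - z\<close>; putting the quotient in place of a row removes this zero from
  the determinant.  The right-hand side can be divided along with it as soon as the scalar condition
  \<open>w p(z) = 0\<close> holds, and one member of the family \<open>P\<close> is spent to enforce it on all the others.\<close>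
lemma disc_solvable_combination:
  assumes "S \<in> carrier_mat N N"
    and "det S = q * (\<Prod>z\<in>#Z. [:-z, 1:])"
    and "disc_unit q" and "finite I" "size Z < card I"
  shows "\<exists>c. (\<exists>i\<in>I. c i \<noteq> 0) \<and> disc_solvable N S (\<lambda>b. \<Sum>i\<in>I. smult (c i) (P i b))"
  using assms
proof (induction Z arbitrary: S q I P)
  case empty
  then obtain i where "i \<in> I" by fastforce
  moreover have "disc_solvable N S (\<lambda>b. \<Sum>i\<in>I. smult 1 (P i b))"
    using empty by (intro disc_solvable_det_unit) auto
  ultimately show ?case by (intro exI[of _ "\<lambda>_. 1"]) auto
next
  case (add z Z)
  note S = add.prems(1)
  have "poly (det S) z = 0" by (simp add: add.prems(2))
  with S obtain a w where a: "a < N" "w a \<noteq> 0"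
    and w: "\<And>j. j < N \<Longrightarrow> (\<Sum>b<N. w b * poly (S $$ (b, j)) z) = 0"
    by (rule left_null_vector) auto
  let ?comb = "\<lambda>f. \<Sum>b<N. smult (w b) (f b)"
  have comb_dvd: "[:-z, 1:] * (?comb f div [:-z, 1:]) = ?comb f" if "(\<Sum>b<N. w b * poly (f b) z) = 0" for f
    using that by (intro dvd_mult_div_cancel) (simp add: poly_eq_0_iff_dvd[symmetric] poly_sum)
  define T where "T = Matrix.mat N N (\<lambda>(b, j). if b = a then ?comb (\<lambda>b. S $$ (b, j)) div [:-z, 1:] else S $$ (b, j))"
  have T: "T \<in> carrier_mat N N" by (simp add: T_def)
  have Ta: "[:-z, 1:] * T $$ (a, j) = ?comb (\<lambda>b. S $$ (b, j))" if "j < N" for j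
    using comb_dvd[OF w[OF that]] that a by (simp add: T_def)
  have Tb: "T $$ (b, j) = S $$ (b, j)" if "b < N" "b \<noteq> a" "j < N" for b j
    using that by (simp add: T_def)
  have "[:-z, 1:] * det T = [:w a:] * det S"
  proof (rule det_row_combination[OF S T a(1) Tb])
    have const: "[:c:] * p = smult c p" for c :: complex and p by simp
    show "[:-z, 1:] * T $$ (a, j) = (\<Sum>b<N. [:w b:] * S $$ (b, j))" if "j < N" for j
      unfolding const by (rule Ta[OF that])
  qed
  also have "\<dots> = [:-z, 1:] * (smult (w a) q * (\<Prod>z\<in>#Z. [:-z, 1:]))"
    by (simp add: add.prems(2) mult_ac del: mult_pCons_left mult_pCons_right) (simp add: mult_ac)
  finally have detT: "det T = smult (w a) q * (\<Prod>z\<in>#Z. [:-z, 1:])"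
    by (subst (asm) mult_cancel_left) simp
  \<comment> \<open>Eliminate with a pivot \<open>e\<close> on which the condition \<open>\<phi>\<close> fails, if there is one; otherwise every
    \<open>\<mu> i\<close> is \<open>0 / 0 = 0\<close> and an arbitrary member is dropped.\<close>
  define \<phi> where "\<phi> f = (\<Sum>b<N. w b * poly (f b) z)" for f
  have "I \<noteq> {}" using add.prems(5) by auto
  then obtain e where e: "e \<in> I" "\<And>i. i \<in> I \<Longrightarrow> \<phi> (P e) = 0 \<Longrightarrow> \<phi> (P i) = 0" by blast
  define \<mu> where "\<mu> i = \<phi> (P i) / \<phi> (P e)" for i
  define P' where "P' i b = P i b - smult (\<mu> i) (P e b)" for i b
  have \<phi>P': "\<phi> (P' i) = 0" if "i \<in> I" for i
  proof -
    have "\<phi> (P' i) = \<phi> (P i) - \<mu> i * \<phi> (P e)"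
      by (simp add: \<phi>_def P'_def algebra_simps sum_subtractf sum_distrib_left)
    then show ?thesis using e(2)[OF that] by (cases "\<phi> (P e) = 0") (auto simp: \<mu>_def)
  qed
  define Q where "Q i b = (if b = a then ?comb (P' i) div [:-z, 1:] else P' i b)" for i b
  have "disc_unit (smult (w a) q)"
    using disc_unit_mult[OF disc_unit_const[OF a(2)] add.prems(3)] by simp
  moreover have "finite (I - {e})" "size Z < card (I - {e})"
    using add.prems(4,5) e(1) by auto
  ultimately obtain c where c: "\<exists>i\<in>I - {e}. c i \<noteq> 0"
    and sol: "disc_solvable N T (\<lambda>b. \<Sum>i\<in>I - {e}. smult (c i) (Q i b))"
    using add.IH[OF T detT] by blast
  have "disc_solvable N S (\<lambda>b. \<Sum>i\<in>I - {e}. smult (c i) (P' i b))"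
  proof (rule disc_solvable_row_combination[OF a Ta Tb _ _ sol])
    have "[:-z, 1:] * (\<Sum>i\<in>I - {e}. smult (c i) (Q i a))
        = (\<Sum>i\<in>I - {e}. smult (c i) (?comb (P' i)))"
      unfolding sum_distrib_left mult_smult_right
      using comb_dvd \<phi>P' unfolding \<phi>_def by (intro sum.cong refl) (auto simp: Q_def simp del: mult_pCons_left)
    also have "\<dots> = ?comb (\<lambda>b. \<Sum>i\<in>I - {e}. smult (c i) (P' i b))"
      unfolding smult_sum_right by (subst sum.swap) (simp add: mult.commute)
    finally show "[:-z, 1:] * (\<Sum>i\<in>I - {e}. smult (c i) (Q i a))
        = ?comb (\<lambda>b. \<Sum>i\<in>I - {e}. smult (c i) (P' i b))" .
  qed (auto simp: Q_def)
  moreover define c' where "c' i = (if i = e then - (\<Sum>i\<in>I - {e}. c i * \<mu> i) else c i)" for i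
  have "(\<Sum>i\<in>I - {e}. smult (c i) (P' i b)) = (\<Sum>i\<in>I. smult (c' i) (P i b))" for b
  proof -
    have "(\<Sum>i\<in>I - {e}. smult (c i) (P' i b))
        = smult (c' e) (P e b) + (\<Sum>i\<in>I - {e}. smult (c i) (P i b))"
      by (simp add: P'_def c'_def smult_diff_right sum_subtractf smult_sum)
    also have "\<dots> = (\<Sum>i\<in>I. smult (c' i) (P i b))"
      using e(1) add.prems(4) by (subst sum.remove[of I e]) (auto simp: c'_def)
    finally show ?thesis .
  qed
  moreover have "\<exists>i\<in>I. c' i \<noteq> 0" using c by (auto simp: c'_def)
  ultimately show ?case by auto
qed

section \<open>Exponentially decaying approximate kernel vectors\<close>

lemma coeff_matrix_poly:
  assumes "p < N" "q < N"
  shows "Polynomial.coeff (matrix_poly N k m M $$ (p, q)) e = band_coeff N k m M (int e - int k) $$ (p, q)"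
proof -
  have "Polynomial.coeff (matrix_poly N k m M $$ (p, q)) e
      = (\<Sum>j\<in>{- int k..int m}. if nat (int k + j) = e then M j $$ (p, q) else 0)"
    using assms by (simp add: matrix_poly_def coeff_sum)
  also have "\<dots> = (\<Sum>j\<in>{- int k..int m}. if j = int e - int k then M j $$ (p, q) else 0)"
    by (intro sum.cong refl if_cong) auto
  finally show ?thesis using assms by (auto simp: band_coeff_def)
qed

text \<open>Let \<open>S x = f\<close> with \<open>f\<close> a nonzero polynomial vector of degree less than \<open>k\<close>.  Comparing the
  coefficients of \<open>t ^ (k + i)\<close> for \<open>i \<ge> 0\<close> says that the coefficients of \<open>x\<close> are annihilated by the
  semi-infinite Toeplitz matrix.  There are \<open>k * N\<close> monomials to build \<open>f\<close> from, and \<open>size Z\<close>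
  conditions to satisfy.\<close>
lemma half_line_kernel:
  assumes detS: "det (matrix_poly N k m M) = q * (\<Prod>z\<in>#Z. [:-z, 1:])"
    and unit: "disc_unit q" and size: "size Z < k * N"
  obtains x where "\<And>b. b < N \<Longrightarrow> 1 < fps_conv_radius (x b)"
    and "\<exists>b<N. x b \<noteq> 0"
    and "\<And>i p. p < N \<Longrightarrow>
      (\<Sum>j\<le>i + k. \<Sum>b<N. band_coeff N k m M (int i - int j) $$ (p, b) * fps_nth (x b) j) = 0"
proof -
  let ?S = "matrix_poly N k m M"
  define I where "I = {..<k} \<times> {..<N}"
  define P where "P = (\<lambda>(e :: nat, b' :: nat) b. if b = b' then Polynomial.monom (1 :: complex) e else 0)"
  have S: "?S \<in> carrier_mat N N" by (simp add: matrix_poly_def)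
  have "finite I" "size Z < card I" using size by (auto simp: I_def)
  with disc_solvable_combination[OF S detS unit, of I P] obtain c
    where c: "\<exists>i\<in>I. c i \<noteq> 0" and sol: "disc_solvable N ?S (\<lambda>b. \<Sum>i\<in>I. smult (c i) (P i b))"
    by blast
  define f where "f b = (\<Sum>i\<in>I. smult (c i) (P i b))" for b
  have coeff_f: "Polynomial.coeff (f b) n = (if n < k then c (n, b) else 0)" if "b < N" for b n
  proof -
    have "Polynomial.coeff (f b) n = (\<Sum>i\<in>I. if i = (n, b) then c i else 0)"
      unfolding f_def coeff_sum by (intro sum.cong refl) (auto simp: P_def split: if_splits)
    then show ?thesis using that by (simp add: I_def)
  qed
  obtain x where rad: "\<And>b. b < N \<Longrightarrow> 1 < fps_conv_radius (x b)"
    and x: "\<And>p. p < N \<Longrightarrow> (\<Sum>b<N. fps_of_poly (?S $$ (p, b)) * x b) = fps_of_poly (f p)"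
    using sol unfolding disc_solvable_def f_def by blast
  have "\<exists>b<N. x b \<noteq> 0"
  proof (rule ccontr)
    assume "\<not> (\<exists>b<N. x b \<noteq> 0)"
    then have "fps_of_poly (f p) = 0" if "p < N" for p
      using x[OF that] by simp
    then have "f p = 0" if "p < N" for p
      using that by (metis fps_of_poly_0 fps_of_poly_eq_iff)
    moreover obtain e b where "e < k" "b < N" "c (e, b) \<noteq> 0"
      using c by (auto simp: I_def)
    ultimately show False using coeff_f[of b e] by simp
  qed
  moreover have "(\<Sum>j\<le>i + k. \<Sum>b<N. band_coeff N k m M (int i - int j) $$ (p, b) * fps_nth (x b) j) = 0"
    if p: "p < N" for i p
  proof -
    have "(\<Sum>j\<le>i + k. \<Sum>b<N. band_coeff N k m M (int i - int j) $$ (p, b) * fps_nth (x b) j)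
        = (\<Sum>b<N. \<Sum>j=0..i + k. fps_nth (x b) j * Polynomial.coeff (?S $$ (p, b)) (i + k - j))"
      unfolding atLeast0AtMost
      using p by (subst sum.swap) (auto simp: coeff_matrix_poly of_nat_diff mult.commute intro!: sum.cong)
    also have "\<dots> = fps_nth (\<Sum>b<N. fps_of_poly (?S $$ (p, b)) * x b) (i + k)"
      unfolding fps_sum_nth by (subst mult.commute) (simp add: fps_mult_nth)
    also have "\<dots> = 0" using p by (simp add: x coeff_f)
    finally show ?thesis .
  qed
  ultimately show ?thesis using that rad by blast
qed

lemma geometric_coeff_bound:
  fixes x :: "nat \<Rightarrow> complex fps"
  assumes "\<And>b. b < N \<Longrightarrow> 1 < fps_conv_radius (x b)"
  shows "\<exists>C r. 0 < r \<and> r < 1 \<and> (\<forall>b<N. \<forall>j. cmod (fps_nth (x b) j) \<le> C * r ^ j)"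
  using assms
proof (induction N)
  case 0
  show ?case by (rule exI[of _ 0], rule exI[of _ "1/2"]) simp
next
  case (Suc N)
  then obtain C1 r1 where 1: "0 < r1" "r1 < 1" "\<And>b j. b < N \<Longrightarrow> cmod (fps_nth (x b) j) \<le> C1 * r1 ^ j"
    by (metis less_SucI)
  obtain R where R: "1 < R" "ereal R < fps_conv_radius (x N)"
    using ereal_dense2[of 1 "fps_conv_radius (x N)"] Suc.prems[of N] by auto
  have "summable (\<lambda>n. fps_nth (x N) n * of_real R ^ n)"
    using R by (intro summable_fps) simp
  then have "Bseq (\<lambda>n. fps_nth (x N) n * of_real R ^ n)"
    by (intro convergent_imp_Bseq convergentI[OF summable_LIMSEQ_zero])
  then obtain K where K: "0 < K" "\<And>n. cmod (fps_nth (x N) n * of_real R ^ n) \<le> K"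
    unfolding Bseq_def by blast
  have 2: "cmod (fps_nth (x N) j) \<le> K * (1 / R) ^ j" for j
    using K(2)[of j] R(1) by (simp add: norm_mult norm_power field_simps)
  define C r where "C = max (max C1 0) K" and "r = max r1 (1 / R)"
  have "cmod (fps_nth (x b) j) \<le> C * r ^ j" if "b < Suc N" for b j
  proof (cases "b = N")
    case True
    have "K * (1 / R) ^ j \<le> C * r ^ j"
      using R(1) K(1) 1(1) by (intro mult_mono power_mono) (auto simp: C_def r_def)
    with 2[of j] True show ?thesis by simp
  next
    case False
    have "C1 * r1 ^ j \<le> C * r ^ j"
      using 1(1) by (intro order_trans[OF mult_right_mono[of C1 C] mult_left_mono] power_mono)
        (auto simp: C_def r_def)
    moreover have "cmod (fps_nth (x b) j) \<le> C1 * r1 ^ j"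
      using False that by (intro 1(3)) simp
    ultimately show ?thesis by simp
  qed
  moreover have "0 < r" "r < 1" using 1 R by (auto simp: r_def)
  ultimately show ?case by blast
qed

text \<open>Vectors are indexed by block and position within the block.  The lower bound asks for
  one large entry, and the residual is measured entrywise; both are easy to convert to Euclidean
  norms and invariant under reversing the order of the blocks.\<close>
definition quasimode ::
  "nat \<Rightarrow> (int \<Rightarrow> complex mat) \<Rightarrow> nat \<Rightarrow> real \<Rightarrow> real \<Rightarrow> (nat \<Rightarrow> nat \<Rightarrow> complex) \<Rightarrow> bool" where
  "quasimode N a n \<xi> \<epsilon> y \<longleftrightarrow> (\<exists>j<n. \<exists>b<N. \<xi> \<le> cmod (y j b)) \<and>
     (\<forall>i<n. \<forall>p<N. cmod (\<Sum>j<n. \<Sum>b<N. a (int i - int j) $$ (p, b) * y j b) \<le> \<epsilon>)"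

definition exponential_quasimodes :: "nat \<Rightarrow> (int \<Rightarrow> complex mat) \<Rightarrow> bool" where
  "exponential_quasimodes N a \<longleftrightarrow> (\<exists>\<xi> C r n0. 0 < \<xi> \<and> 0 < r \<and> r < 1 \<and>
     (\<forall>n\<ge>n0. \<exists>y. quasimode N a n \<xi> (C * r ^ n) y))"

text \<open>Cut a kernel vector of the semi-infinite matrix off after \<open>n\<close> blocks.  The residual consists of
  the terms lost, at most \<open>k\<close> blocks per row because of the band, and each is of the size of
  the coefficients beyond \<open>n\<close>.\<close>
lemma quasimodes_if_few_zeros:
  assumes "det (matrix_poly N k m M) = q * (\<Prod>z\<in>#Z. [:-z, 1:])"
    and "disc_unit q" and "size Z < k * N"
  shows "exponential_quasimodes N (band_coeff N k m M)"
proof -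
  let ?a = "band_coeff N k m M"
  obtain x where rad: "\<And>b. b < N \<Longrightarrow> 1 < fps_conv_radius (x b)"
    and nz: "\<exists>b<N. x b \<noteq> 0"
    and ker: "\<And>i p. p < N \<Longrightarrow> (\<Sum>j\<le>i + k. \<Sum>b<N. ?a (int i - int j) $$ (p, b) * fps_nth (x b) j) = 0"
    using half_line_kernel[OF assms] by blast
  obtain C r where r: "0 < r" "r < 1" and C: "\<And>b j. b < N \<Longrightarrow> cmod (fps_nth (x b) j) \<le> C * r ^ j"
    using geometric_coeff_bound[of N x] rad by blast
  obtain b0 j0 where b0: "b0 < N" "fps_nth (x b0) j0 \<noteq> 0"
    using nz by (auto simp: fps_eq_iff)
  have "0 \<le> C" using order_trans[OF norm_ge_zero C[OF b0(1), of 0]] by simp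
  define B where "B = (\<Sum>t\<in>{-int k..int m}. \<Sum>p<N. \<Sum>b<N. cmod (M t $$ (p, b)))"
  have "0 \<le> B" unfolding B_def by (intro sum_nonneg) auto
  have B: "cmod (?a t $$ (p, b)) \<le> B" if "p < N" "b < N" for t p b
  proof (cases "t \<in> {-int k..int m}")
    case True
    have "cmod (M t $$ (p, b)) \<le> (\<Sum>b<N. cmod (M t $$ (p, b)))"
      using that by (intro member_le_sum) auto
    also have "\<dots> \<le> (\<Sum>p<N. \<Sum>b<N. cmod (M t $$ (p, b)))"
      using that by (intro member_le_sum[where f = "\<lambda>p. \<Sum>b<N. cmod (M t $$ (p, b))"]) (auto intro: sum_nonneg)
    also have "\<dots> \<le> B" unfolding B_def
      using True by (intro member_le_sum[where f = "\<lambda>t. \<Sum>p<N. \<Sum>b<N. cmod (M t $$ (p, b))"]) (auto intro!: sum_nonneg)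
    finally show ?thesis using True by (simp add: band_coeff_def)
  qed (use that \<open>0 \<le> B\<close> in \<open>auto simp: band_coeff_def\<close>)
  have "cmod (\<Sum>j<n. \<Sum>b<N. ?a (int i - int j) $$ (p, b) * fps_nth (x b) j)
      \<le> (real k * (real N * (B * C))) * r ^ n" if i: "i < n" and p: "p < N" for n i p
  proof -
    define h where "h j = (\<Sum>b<N. ?a (int i - int j) $$ (p, b) * fps_nth (x b) j)" for j
    \<comment> \<open>Row \<open>i\<close> of the matrix vanishes beyond block \<open>i + k\<close>.\<close>
    have "sum h {..<n + k} = sum h {..i + k}"
      using i p by (intro sum.mono_neutral_right) (auto simp: h_def band_coeff_def intro!: sum.neutral)
    also have "\<dots> = 0" unfolding h_def by (rule ker[OF p])
    finally have "sum h {..<n} = - sum h {n..<n + k}"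
      using sum.atLeastLessThan_concat[of 0 n "n + k" h] by (simp add: atLeast0LessThan eq_neg_iff_add_eq_0)
    then have "cmod (sum h {..<n}) = cmod (sum h {n..<n + k})" by simp
    also have "\<dots> \<le> real (card {n..<n + k}) * (real N * (B * C) * r ^ n)"
    proof (rule sum_norm_bound)
      fix j assume j: "j \<in> {n..<n + k}"
      have "cmod (h j) \<le> real (card {..<N}) * (B * (C * r ^ n))" unfolding h_def
      proof (rule sum_norm_bound)
        fix b assume b: "b \<in> {..<N}"
        have "cmod (fps_nth (x b) j) \<le> C * r ^ j" using C b by simp
        also have "\<dots> \<le> C * r ^ n"
          using j r \<open>0 \<le> C\<close> by (intro mult_left_mono power_decreasing) auto
        finally show "cmod (?a (int i - int j) $$ (p, b) * fps_nth (x b) j) \<le> B * (C * r ^ n)"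
          unfolding norm_mult using B[OF p, of b] b \<open>0 \<le> B\<close> by (intro mult_mono) auto
      qed
      then show "cmod (h j) \<le> real N * (B * C) * r ^ n" by (simp add: mult_ac)
    qed
    finally show ?thesis by (simp add: h_def mult_ac)
  qed
  moreover have "\<exists>j<n. \<exists>b<N. cmod (fps_nth (x b0) j0) \<le> cmod (fps_nth (x b) j)" if "n \<ge> Suc j0" for n
    using that b0 by (intro exI[of _ j0]) auto
  ultimately have "quasimode N ?a n (cmod (fps_nth (x b0) j0)) (real k * (real N * (B * C)) * r ^ n)
      (\<lambda>j b. fps_nth (x b) j)" if "n \<ge> Suc j0" for n
    using that unfolding quasimode_def by simp
  moreover have "0 < cmod (fps_nth (x b0) j0)" using b0 by simp
  ultimately show ?thesis unfolding exponential_quasimodes_def using r by blast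
qed

section \<open>Reversing the order of the blocks\<close>

lemma quasimode_reverse:
  assumes "quasimode N (\<lambda>j. a (- j)) n \<xi> \<epsilon> y"
  shows "quasimode N a n \<xi> \<epsilon> (\<lambda>j. y (n - Suc j))"
  unfolding quasimode_def
proof (intro conjI allI impI)
  obtain j0 b0 where "j0 < n" "b0 < N" "\<xi> \<le> cmod (y j0 b0)"
    using assms unfolding quasimode_def by blast
  then show "\<exists>j<n. \<exists>b<N. \<xi> \<le> cmod (y (n - Suc j) b)"
    by (intro exI[of _ "n - Suc j0"]) auto
next
  fix i p assume ip: "i < n" "p < N"
  have "(\<Sum>j<n. \<Sum>b<N. a (int i - int j) $$ (p, b) * y (n - Suc j) b)
      = (\<Sum>j<n. \<Sum>b<N. a (- (int (n - Suc i) - int (n - Suc j))) $$ (p, b) * y (n - Suc j) b)"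
    using ip by (intro sum.cong refl) (simp add: of_nat_diff)
  also have "\<dots> = (\<Sum>j<n. \<Sum>b<N. a (- (int (n - Suc i) - int j)) $$ (p, b) * y j b)"
    by (rule sum.nat_diff_reindex)
  finally have rows: "(\<Sum>j<n. \<Sum>b<N. a (int i - int j) $$ (p, b) * y (n - Suc j) b)
      = (\<Sum>j<n. \<Sum>b<N. a (- (int (n - Suc i) - int j)) $$ (p, b) * y j b)" .
  have "cmod (\<Sum>j<n. \<Sum>b<N. a (- (int i - int j)) $$ (p, b) * y j b) \<le> \<epsilon>"
    if "i < n" "p < N" for i p
    using assms that unfolding quasimode_def by blast
  from this[of "n - Suc i" p]
  show "cmod (\<Sum>j<n. \<Sum>b<N. a (int i - int j) $$ (p, b) * y (n - Suc j) b) \<le> \<epsilon>"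
    unfolding rows using ip by linarith
qed

lemma exponential_quasimodes_reverse:
  "exponential_quasimodes N (\<lambda>j. a (- j)) \<Longrightarrow> exponential_quasimodes N a"
  unfolding exponential_quasimodes_def using quasimode_reverse[of N a] by meson

text \<open>The reversed matrix polynomial is \<open>t ^ (k + m) S(1 / t)\<close>.\<close>
lemma poly_det_matrix_poly_reverse:
  assumes t: "t \<noteq> 0"
  shows "poly (det (matrix_poly N m k (\<lambda>j. M (- j)))) t
    = t ^ ((k + m) * N) * poly (det (matrix_poly N k m M)) (1 / t)"
proof -
  have hom: "poly (det A) z = det (map_mat (\<lambda>p. poly p z) A)" for A and z :: complex
  proof -
    interpret comm_ring_hom "\<lambda>p. poly p z" by unfold_locales auto
    show ?thesis by simp
  qed
  have "map_mat (\<lambda>p. poly p t) (matrix_poly N m k (\<lambda>j. M (- j)))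
      = t ^ (k + m) \<cdot>\<^sub>m map_mat (\<lambda>p. poly p (1 / t)) (matrix_poly N k m M)"
  proof (rule eq_matI)
    fix p q
    assume pq: "p < dim_row (t ^ (k + m) \<cdot>\<^sub>m map_mat (\<lambda>p. poly p (1 / t)) (matrix_poly N k m M))"
      "q < dim_col (t ^ (k + m) \<cdot>\<^sub>m map_mat (\<lambda>p. poly p (1 / t)) (matrix_poly N k m M))"
    have "(\<Sum>j\<in>{- int m..int k}. M (- j) $$ (p, q) * t ^ nat (int m + j))
        = (\<Sum>j\<in>{- int k..int m}. M j $$ (p, q) * t ^ nat (int m - j))"
      by (rule sum.reindex_bij_witness[of _ uminus uminus]) auto
    also have "\<dots> = (\<Sum>j\<in>{- int k..int m}. t ^ (k + m) * (M j $$ (p, q) * (1 / t) ^ nat (int k + j)))"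
    proof (rule sum.cong[OF refl])
      fix j assume "j \<in> {- int k..int m}"
      then have "k + m = nat (int m - j) + nat (int k + j)" by auto
      then have "t ^ (k + m) = t ^ nat (int m - j) * t ^ nat (int k + j)" by (metis power_add)
      then show "M j $$ (p, q) * t ^ nat (int m - j) = t ^ (k + m) * (M j $$ (p, q) * (1 / t) ^ nat (int k + j))"
        using t by (simp add: power_divide)
    qed
    finally show "map_mat (\<lambda>p. poly p t) (matrix_poly N m k (\<lambda>j. M (- j))) $$ (p, q)
      = (t ^ (k + m) \<cdot>\<^sub>m map_mat (\<lambda>p. poly p (1 / t)) (matrix_poly N k m M)) $$ (p, q)"
      using pq by (simp add: matrix_poly_def poly_sum poly_monom sum_distrib_left)
  qed (auto simp: matrix_poly_def)
  then show ?thesis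
    unfolding hom by (simp add: det_smult matrix_poly_def power_mult)
qed

lemma poly_prod_reversed:
  fixes t :: complex
  assumes "t \<noteq> 0"
  shows "t ^ size Z * poly (\<Prod>z\<in>#Z. [:-z, 1:]) (1 / t) = poly (\<Prod>z\<in>#Z. [:1, -z:]) t"
proof (induction Z)
  case (add z Z)
  have "t ^ size (add_mset z Z) * poly (\<Prod>z\<in>#add_mset z Z. [:-z, 1:]) (1 / t)
      = (t * (1 / t - z)) * (t ^ size Z * poly (\<Prod>z\<in>#Z. [:-z, 1:]) (1 / t))"
    by (simp add: algebra_simps)
  also have "t * (1 / t - z) = 1 - z * t" using assms by (simp add: field_simps)
  finally show ?case unfolding add.IH by (simp add: algebra_simps)
qed simp

lemma poly_eqI_nonzero:
  fixes p q :: "complex poly"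
  assumes "\<And>t. t \<noteq> 0 \<Longrightarrow> poly p t = poly q t"
  shows "p = q"
proof -
  have "poly ([:0, 1:] * (p - q)) t = 0" for t using assms[of t] by (cases "t = 0") auto
  then have "[:0, 1:] * (p - q) = 0" using poly_all_0_iff_0 by blast
  then show ?thesis by simp
qed

text \<open>Reversal turns a factor \<open>t - z\<close> into \<open>1 - z t\<close>, and the amount by which the degree of \<open>det S\<close> falls
  short of \<open>(k + m) * N\<close> becomes the multiplicity of the zero at the origin.  The degree cannot exceed
  \<open>(k + m) * N\<close>, since the reversed determinant would then have a pole at the origin.\<close>
lemma det_matrix_poly_reverse:
  fixes M :: "int \<Rightarrow> complex mat"
  assumes c: "c \<noteq> 0"
    and detS: "det (matrix_poly N k m M) = smult c ((\<Prod>z\<in>#I. [:-z, 1:]) * (\<Prod>z\<in>#Z. [:-z, 1:]))"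
  shows "size I + size Z \<le> (k + m) * N"
    and "det (matrix_poly N m k (\<lambda>j. M (- j)))
      = [:0, 1:] ^ ((k + m) * N - (size I + size Z)) * smult c ((\<Prod>z\<in>#I. [:1, -z:]) * (\<Prod>z\<in>#Z. [:1, -z:]))"
proof -
  let ?S' = "matrix_poly N m k (\<lambda>j. M (- j))" and ?D = "size I + size Z" and ?K = "(k + m) * N"
  let ?R = "smult c ((\<Prod>z\<in>#I. [:1, -z:]) * (\<Prod>z\<in>#Z. [:1, -z:]))"
  have eq: "[:0, 1:] ^ ?D * det ?S' = [:0, 1:] ^ ?K * ?R"
  proof (rule poly_eqI_nonzero)
    fix t :: complex assume t: "t \<noteq> 0"
    have "poly ([:0, 1:] ^ ?D * det ?S') t
        = t ^ ?K * (c * ((t ^ size I * poly (\<Prod>z\<in>#I. [:-z, 1:]) (1 / t)) *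
            (t ^ size Z * poly (\<Prod>z\<in>#Z. [:-z, 1:]) (1 / t))))"
      by (simp add: poly_det_matrix_poly_reverse[OF t] detS power_add mult_ac)
    also have "\<dots> = poly ([:0, 1:] ^ ?K * ?R) t"
      unfolding poly_prod_reversed[OF t] by simp
    finally show "poly ([:0, 1:] ^ ?D * det ?S') t = poly ([:0, 1:] ^ ?K * ?R) t" .
  qed
  have cancel: "p = q" if "[:0, 1:] ^ n * p = [:0, 1:] ^ n * q" for n and p q :: "complex poly"
    using that by simp
  have split: "[:0, 1:] ^ n * p = [:0, 1:] ^ n' * ([:0, 1:] ^ (n - n') * p)" if "n' \<le> n"
    for n n' and p :: "complex poly"
    unfolding mult.assoc[symmetric] power_add[symmetric] using that by simp
  show D: "?D \<le> ?K"
  proof (rule ccontr)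
    assume *: "\<not> ?D \<le> ?K"
    then have "[:0, 1:] ^ ?K * ([:0, 1:] ^ (?D - ?K) * det ?S') = [:0, 1:] ^ ?K * ?R"
      unfolding eq[symmetric] by (intro split[symmetric]) simp
    then have R: "[:0, 1:] ^ (?D - ?K) * det ?S' = ?R" by (rule cancel)
    have "poly ?R 0 = 0"
      unfolding R[symmetric] poly_mult poly_power using * by (simp add: power_0_left)
    moreover have "poly (\<Prod>z\<in>#Y. [:1, -z:]) 0 = 1" for Y :: "complex multiset"
      by (induction Y) auto
    ultimately show False using c by simp
  qed
  have "[:0, 1:] ^ ?D * det ?S' = [:0, 1:] ^ ?D * ([:0, 1:] ^ (?K - ?D) * ?R)"
    unfolding eq by (rule split[OF D])
  then show "det ?S' = [:0, 1:] ^ (?K - ?D) * ?R" by (rule cancel)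
qed

text \<open>If there are too many zeros in the disc rather than too few, the reversed symbol has too few:
  it has \<open>(k + m) * N - s\<close> zeros inside, which is less than \<open>m * N\<close>, and \<open>m\<close> plays the role of \<open>k\<close>.\<close>
lemma quasimodes_if_nonzero_index:
  fixes M :: "int \<Rightarrow> complex mat"
  assumes type: "matrix_poly_type (matrix_poly N k m M) s 0 l" and s: "s \<noteq> k * N"
  shows "exponential_quasimodes N (band_coeff N k m M)"
proof -
  define d where "d = det (matrix_poly N k m M)"
  define I where "I = filter_mset (\<lambda>z. cmod z < 1) (proots d)"
  define Z where "Z = filter_mset (\<lambda>z. cmod z > 1) (proots d)"
  have d: "d \<noteq> 0" and size_I: "size I = s"
    and circle: "filter_mset (\<lambda>z. cmod z = 1) (proots d) = {#}"
    using type by (auto simp: matrix_poly_type_def d_def I_def)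
  have "filter_mset (\<lambda>z. \<not> cmod z < 1) (proots d) = Z"
    unfolding Z_def using circle by (intro filter_mset_cong refl) fastforce
  then have "proots d = I + Z"
    unfolding I_def using multiset_partition[of "proots d" "\<lambda>z. cmod z < 1"] by simp
  then have dfac: "d = smult (lead_coeff d) ((\<Prod>z\<in>#I. [:-z, 1:]) * (\<Prod>z\<in>#Z. [:-z, 1:]))"
    using complex_poly_decompose_multiset[of d] by simp
  have c: "lead_coeff d \<noteq> 0" using d by simp
  have I: "cmod z < 1" if "z \<in># I" for z using that by (simp add: I_def)
  have Z: "cmod z > 1" if "z \<in># Z" for z using that by (simp add: Z_def)
  consider "s < k * N" | "s > k * N" using s by linarith
  then show ?thesis
  proof cases
    case 1
    have "disc_unit ([:lead_coeff d:] * (\<Prod>z\<in>#Z. [:-z, 1:]))"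
      using c Z by (intro disc_unit_mult disc_unit_const disc_unit_prod_mset disc_unit_linear) auto
    moreover have "d = [:lead_coeff d:] * (\<Prod>z\<in>#Z. [:-z, 1:]) * (\<Prod>z\<in>#I. [:-z, 1:])"
      using dfac by (simp add: mult_ac)
    ultimately show ?thesis
      using 1 size_I unfolding d_def by (intro quasimodes_if_few_zeros) auto
  next
    case 2
    let ?e = "(k + m) * N - (size I + size Z)"
    define q where "q = [:lead_coeff d:] * (\<Prod>z\<in>#Z. [:-z:]) * (\<Prod>z\<in>#I. [:1, -z:])"
    define Z' where "Z' = replicate_mset ?e 0 + image_mset (\<lambda>z. 1 / z) Z"
    have "det (matrix_poly N k m M) = smult (lead_coeff d) ((\<Prod>z\<in>#I. [:-z, 1:]) * (\<Prod>z\<in>#Z. [:-z, 1:]))"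
      using dfac unfolding d_def .
    note rev = det_matrix_poly_reverse[OF c this]
    \<comment> \<open>The zeros outside the disc move inside, and \<open>1 - z t = - z (t - 1 / z)\<close> exhibits them; the zeros
      inside move outside or, at the origin, disappear, so that their factors belong to \<open>q\<close>.\<close>
    have "(\<Prod>z\<in>#Z. [:1, -z:]) = (\<Prod>z\<in>#Z. [:-z:] * [:- (1 / z), 1:])"
      using Z by (intro arg_cong[of _ _ prod_mset] image_mset_cong) fastforce
    also have "\<dots> = (\<Prod>z\<in>#Z. [:-z:]) * (\<Prod>z\<in>#image_mset (\<lambda>z. 1 / z) Z. [:-z, 1:])"
      by (simp only: prod_mset.distrib image_mset.compositionality o_def)
    finally have "det (matrix_poly N m k (\<lambda>j. M (- j))) = q * (\<Prod>z\<in>#Z'. [:-z, 1:])"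
      using rev(2) by (simp add: q_def Z'_def mult_ac)
    moreover have "disc_unit q" unfolding q_def using c I Z
      by (intro disc_unit_mult disc_unit_prod_mset disc_unit_const disc_unit_linear) fastforce+
    moreover have "size Z' < m * N"
      using rev(1) 2 size_I by (simp add: Z'_def add_mult_distrib)
    ultimately have "exponential_quasimodes N (band_coeff N m k (\<lambda>j. M (- j)))"
      by (rule quasimodes_if_few_zeros)
    also have "band_coeff N m k (\<lambda>j. M (- j)) = (\<lambda>j. band_coeff N k m M (- j))"
      by (auto simp: band_coeff_def fun_eq_iff)
    finally show ?thesis by (rule exponential_quasimodes_reverse)
  qed
qed

section \<open>Lower bounds for the condition number\<close>

lemma euclidean_norm_nonneg: "0 \<le> euclidean_norm v"
  by (simp add: euclidean_norm_def)

lemma euclidean_norm_smult: "euclidean_norm (c \<cdot>\<^sub>v v) = cmod c * euclidean_norm v"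
  unfolding euclidean_norm_def L2_set_right_distrib[OF norm_ge_zero]
  by (simp, intro L2_set_cong) (auto simp: norm_mult)

lemma euclidean_norm_eq_0: "euclidean_norm v = 0 \<Longrightarrow> v = 0\<^sub>v (dim_vec v)"
  by (intro eq_vecI) (auto simp: euclidean_norm_def L2_set_eq_0_iff)

lemma cmod_le_euclidean_norm: "i < dim_vec v \<Longrightarrow> cmod (v $ i) \<le> euclidean_norm v"
  unfolding euclidean_norm_def by (intro member_le_L2_set) auto

lemma euclidean_norm_unit_vec: "i < n \<Longrightarrow> euclidean_norm (unit_vec n i) = 1"
proof -
  assume i: "i < n"
  have "(\<Sum>j<n. (cmod (unit_vec n i $ j))\<^sup>2) = (\<Sum>j<n. if j = i then 1 else 0)"
    using i by (intro sum.cong refl) auto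
  then show ?thesis using i by (simp add: euclidean_norm_def L2_set_def)
qed

lemma euclidean_norm_mult_le:
  assumes v: "v \<in> carrier_vec (dim_col A)"
  shows "euclidean_norm (A *\<^sub>v v) \<le> spectral_norm A * euclidean_norm v"
proof (cases "euclidean_norm v = 0")
  case True
  then have "v = 0\<^sub>v (dim_col A)" using euclidean_norm_eq_0 v by force
  then have "A *\<^sub>v v = 0\<^sub>v (dim_row A)" by (intro eq_vecI) auto
  then show ?thesis using True by (simp add: euclidean_norm_def L2_set_def)
next
  case False
  define s where "s = euclidean_norm v"
  have s: "0 < s" using False euclidean_norm_nonneg[of v] by (simp add: s_def)
  let ?u = "complex_of_real (1 / s) \<cdot>\<^sub>v v"
  have "euclidean_norm (A *\<^sub>v ?u) \<le> spectral_norm A"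
    unfolding spectral_norm_def
    by (rule cSUP_upper[OF _ bdd_above_spectral_norm])
      (use v s in \<open>simp add: euclidean_norm_smult s_def[symmetric] del: of_real_divide\<close>)
  moreover have "A *\<^sub>v ?u = complex_of_real (1 / s) \<cdot>\<^sub>v (A *\<^sub>v v)"
    using v by (intro mult_mat_vec[of _ "dim_row A" "dim_col A"]) auto
  ultimately have "1 / s * euclidean_norm (A *\<^sub>v v) \<le> spectral_norm A"
    using s by (simp add: euclidean_norm_smult norm_divide)
  then show ?thesis using s unfolding s_def[symmetric] by (simp add: field_simps)
qed

lemma cmod_entry_le_spectral_norm:
  assumes "i < dim_row A" "j < dim_col A"
  shows "cmod (A $$ (i, j)) \<le> spectral_norm A"
proof -
  have "A $$ (i, j) = (A *\<^sub>v unit_vec (dim_col A) j) $ i" using assms by simp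
  then have "cmod (A $$ (i, j)) \<le> euclidean_norm (A *\<^sub>v unit_vec (dim_col A) j)"
    using cmod_le_euclidean_norm[of i "A *\<^sub>v unit_vec (dim_col A) j"] assms by simp
  also have "\<dots> \<le> spectral_norm A * 1"
    using euclidean_norm_mult_le[of "unit_vec (dim_col A) j" A] assms
    by (simp add: euclidean_norm_unit_vec)
  finally show ?thesis by simp
qed

lemma spectral_norm_nonneg: "0 \<le> spectral_norm A"
proof -
  have "euclidean_norm (A *\<^sub>v 0\<^sub>v (dim_col A)) \<le> spectral_norm A"
    unfolding spectral_norm_def
    by (rule cSUP_upper[OF _ bdd_above_spectral_norm]) (simp add: euclidean_norm_def L2_set_def)
  with euclidean_norm_nonneg show ?thesis by (rule order_trans)
qed

lemma euclidean_norm_le_inverse: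
  assumes A: "A \<in> carrier_mat d d" and inv: "mat_inverse A = Some B" and v: "v \<in> carrier_vec d"
  shows "euclidean_norm v \<le> spectral_norm B * euclidean_norm (A *\<^sub>v v)"
proof -
  have B: "B * A = 1\<^sub>m d" "B \<in> carrier_mat d d" using mat_inverse(2)[OF A inv] by auto
  have "v = (B * A) *\<^sub>v v" using B(1) v by simp
  also have "\<dots> = B *\<^sub>v (A *\<^sub>v v)" by (rule assoc_mult_mat_vec[OF B(2) A v])
  finally have "euclidean_norm v = euclidean_norm (B *\<^sub>v (A *\<^sub>v v))" by simp
  also have "\<dots> \<le> spectral_norm B * euclidean_norm (A *\<^sub>v v)"
    using mult_mat_vec_carrier[OF A v] carrier_matD(2)[OF B(2)]
    by (intro euclidean_norm_mult_le) simp
  finally show ?thesis .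
qed

lemma one_le_condition_number:
  assumes A: "A \<in> carrier_mat d d" and d: "0 < d"
  shows "1 \<le> condition_number A"
proof (cases "mat_inverse A")
  case (Some B)
  let ?u = "unit_vec d 0"
  have "1 \<le> spectral_norm B * euclidean_norm (A *\<^sub>v ?u)"
    using euclidean_norm_le_inverse[OF A Some, of ?u] d by (simp add: euclidean_norm_unit_vec)
  also have "\<dots> \<le> spectral_norm B * (spectral_norm A * 1)"
    using euclidean_norm_mult_le[of ?u A] A d
    by (intro mult_left_mono) (auto simp: euclidean_norm_unit_vec spectral_norm_nonneg)
  finally show ?thesis using Some by (simp add: condition_number_def mult.commute)
qed (simp add: condition_number_def)

lemma condition_number_ge:
  assumes A: "A \<in> carrier_mat d d" and ij: "i < d" "j < d" and v: "v \<in> carrier_vec d"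
    and \<delta>: "\<delta> \<le> cmod (A $$ (i, j))" "0 < \<delta>"
    and \<xi>: "\<xi> \<le> euclidean_norm v" "0 < \<xi>"
    and \<epsilon>: "euclidean_norm (A *\<^sub>v v) \<le> \<epsilon>"
  shows "ereal (\<delta> * \<xi> / \<epsilon>) \<le> condition_number A"
proof (cases "mat_inverse A")
  case (Some B)
  have "\<xi> \<le> spectral_norm B * euclidean_norm (A *\<^sub>v v)"
    using euclidean_norm_le_inverse[OF A Some v] \<xi> by simp
  also have "\<dots> \<le> spectral_norm B * \<epsilon>"
    using \<epsilon> by (intro mult_left_mono spectral_norm_nonneg)
  finally have 1: "\<xi> \<le> spectral_norm B * \<epsilon>" .
  then have pos: "0 < \<epsilon>"
    using \<xi>(2) spectral_norm_nonneg[of B] by (metis less_le_trans zero_less_mult_iff not_le)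
  have "\<delta> \<le> spectral_norm A"
    using \<delta>(1) cmod_entry_le_spectral_norm[of i A j] A ij by auto
  with 1 have "\<delta> * \<xi> \<le> spectral_norm A * (spectral_norm B * \<epsilon>)"
    using \<delta> \<xi> by (intro mult_mono spectral_norm_nonneg) auto
  then show ?thesis using Some pos by (simp add: condition_number_def field_simps)
qed (simp add: condition_number_def)

lemma sum_blocks:
  fixes f :: "nat \<Rightarrow> nat \<Rightarrow> 'a :: comm_monoid_add"
  shows "(\<Sum>q<n * N. f (q div N) (q mod N)) = (\<Sum>j<n. \<Sum>b<N. f j b)"
proof -
  have "(\<Sum>q<n * N. f (q div N) (q mod N)) = (\<Sum>j<n. \<Sum>q\<in>{j * N..<j * N + N}. f (q div N) (q mod N))"
    by (rule sum.nat_group[symmetric])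
  also have "\<dots> = (\<Sum>j<n. \<Sum>b<N. f j b)"
  proof (rule sum.cong[OF refl])
    fix j
    have "(\<Sum>q\<in>{j * N..<j * N + N}. f (q div N) (q mod N)) = (\<Sum>b\<in>{0..<N}. f ((b + j * N) div N) ((b + j * N) mod N))"
      using sum.shift_bounds_nat_ivl[of "\<lambda>q. f (q div N) (q mod N)" 0 "j * N" N] by (simp add: add.commute)
    also have "\<dots> = (\<Sum>b<N. f j b)"
      by (intro sum.cong) auto
    finally show "(\<Sum>q\<in>{j * N..<j * N + N}. f (q div N) (q mod N)) = (\<Sum>b<N. f j b)" .
  qed
  finally show ?thesis .
qed

lemma condition_number_ge_quasimode:
  assumes quasi: "quasimode N a n \<xi> \<epsilon> y" and \<xi>: "0 < \<xi>"
    and entry: "p < N" "q < N" "a t $$ (p, q) \<noteq> 0" "nat \<bar>t\<bar> < n"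
  shows "ereal (cmod (a t $$ (p, q)) * \<xi> / (real (n * N) * \<epsilon>)) \<le> condition_number (block_toeplitz N n a)"
proof -
  let ?T = "block_toeplitz N n a"
  have index: "j * N + b < n * N" "(j * N + b) div N = j" "(j * N + b) mod N = b" if "j < n" "b < N" for j b
  proof -
    have "j * N + b < Suc j * N" using that by simp
    also have "\<dots> \<le> n * N" using that by (intro mult_right_mono) auto
    finally show "j * N + b < n * N" .
  qed (use that in auto)
  have T: "?T \<in> carrier_mat (n * N) (n * N)" by (simp add: block_toeplitz_def)
  define v where "v = Matrix.vec (n * N) (\<lambda>i. y (i div N) (i mod N))"
  have v: "v \<in> carrier_vec (n * N)" by (simp add: v_def)
  obtain j b where jb: "j < n" "b < N" "\<xi> \<le> cmod (y j b)"
    using quasi unfolding quasimode_def by blast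
  have "\<xi> \<le> cmod (v $ (j * N + b))" using jb index[of j b] by (simp add: v_def)
  also have "\<dots> \<le> euclidean_norm v"
    using index[of j b] jb by (intro cmod_le_euclidean_norm) (simp add: v_def)
  finally have norm_v: "\<xi> \<le> euclidean_norm v" .
  have row: "cmod ((?T *\<^sub>v v) $ i) \<le> \<epsilon>" if i: "i < n * N" for i
  proof -
    have N: "0 < N" using entry by simp
    have "(?T *\<^sub>v v) $ i
        = (\<Sum>q<n * N. a (int (i div N) - int (q div N)) $$ (i mod N, q mod N) * y (q div N) (q mod N))"
      using i by (simp add: block_toeplitz_def v_def scalar_prod_def atLeast0LessThan)
    also have "\<dots> = (\<Sum>j<n. \<Sum>b<N. a (int (i div N) - int j) $$ (i mod N, b) * y j b)"
      by (rule sum_blocks)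
    finally show ?thesis
      using quasi i N unfolding quasimode_def by (simp add: less_mult_imp_div_less)
  qed
  have "euclidean_norm (?T *\<^sub>v v) \<le> (\<Sum>i<n * N. cmod ((?T *\<^sub>v v) $ i))"
    using L2_set_le_sum[of "{..<n * N}" "\<lambda>i. cmod ((?T *\<^sub>v v) $ i)"] T by (simp add: euclidean_norm_def)
  also have "\<dots> \<le> real (card {..<n * N}) * \<epsilon>"
    using row by (intro sum_bounded_above) auto
  finally have norm_Tv: "euclidean_norm (?T *\<^sub>v v) \<le> real (n * N) * \<epsilon>" by simp
  have t: "nat t < n" "nat (- t) < n" "int (nat t) - int (nat (- t)) = t" using entry(4) by auto
  have "?T $$ (nat t * N + p, nat (- t) * N + q) = a t $$ (p, q)"
    using index[OF t(1) entry(1)] index[OF t(2) entry(2)] t(3) by (simp add: block_toeplitz_def)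
  then show ?thesis
    using condition_number_ge[OF T index(1)[OF t(1) entry(1)] index(1)[OF t(2) entry(2)] v _ _ norm_v \<xi> norm_Tv]
      entry(3) by simp
qed

text \<open>A fixed nonzero entry bounds the norm of the matrices from below, so the quasimodes make the
  condition number grow at least like \<open>1 / (n r ^ n)\<close>.  Half of the decay, \<open>\<rho> ^ n\<close> with \<open>\<rho> = sqrt r\<close>, absorbs
  the factor \<open>n\<close>.  For the finitely many remaining \<open>n\<close> the condition number is at least 1, which
  suffices once \<open>c\<close> is small.\<close>
lemma condition_number_exponential:
  assumes quasi: "exponential_quasimodes N a"
    and entry: "p < N" "q < N" "a t $$ (p, q) \<noteq> 0"
  shows "\<exists>c \<alpha> :: real. c > 0 \<and> \<alpha> > 0 \<and>
    (\<forall>n::nat. n \<ge> 1 \<longrightarrow> ereal (c * exp (\<alpha> * real n)) \<le> condition_number (block_toeplitz N n a))"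
proof -
  obtain \<xi> C r n0 where \<xi>: "0 < \<xi>" and r: "0 < r" "r < 1"
    and quasi: "\<And>n. n \<ge> n0 \<Longrightarrow> \<exists>y. quasimode N a n \<xi> (C * r ^ n) y"
    using assms(1) unfolding exponential_quasimodes_def by blast
  define \<rho> where "\<rho> = sqrt r"
  have \<rho>: "0 < \<rho>" "\<rho> < 1" "r = \<rho> * \<rho>" using r by (auto simp: \<rho>_def)
  have "Bseq (\<lambda>n. real n * \<rho> ^ n)"
    using \<rho> by (intro convergent_imp_Bseq convergentI[OF powser_times_n_limit_0]) auto
  then obtain K where K: "0 < K" "\<And>n. \<bar>real n * \<rho> ^ n\<bar> \<le> K"
    unfolding Bseq_def by auto
  define L where "L = real N * (\<bar>C\<bar> + 1) * K"
  have L: "0 < L" using K entry by (auto simp: L_def)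
  define \<delta> where "\<delta> = cmod (a t $$ (p, q))"
  have \<delta>: "0 < \<delta>" using entry by (simp add: \<delta>_def)
  define \<alpha> where "\<alpha> = - ln \<rho>"
  have \<alpha>: "0 < \<alpha>" using \<rho> by (simp add: \<alpha>_def)
  have exp_\<alpha>: "exp (\<alpha> * real n) = 1 / \<rho> ^ n" for n
    using \<rho> by (simp add: \<alpha>_def exp_minus exp_of_nat_mult[symmetric] mult.commute[of "ln \<rho>"] exp_of_nat_mult inverse_eq_divide power_divide)
  define n1 where "n1 = max n0 (Suc (nat \<bar>t\<bar>))"
  define c where "c = min (\<delta> * \<xi> / L) (exp (- (\<alpha> * real n1)))"
  have c: "0 < c" using \<delta> \<xi> L by (simp add: c_def)
  have "ereal (c * exp (\<alpha> * real n)) \<le> condition_number (block_toeplitz N n a)" if n: "n \<ge> 1" for n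
  proof (cases "n \<ge> n1")
    case True
    then obtain y where "quasimode N a n \<xi> (C * r ^ n) y" using quasi[of n] by (auto simp: n1_def)
    \<comment> \<open>Nothing is known about the sign of \<open>C\<close>, while a positive residual bound is divided by below.\<close>
    then have "quasimode N a n \<xi> ((\<bar>C\<bar> + 1) * r ^ n) y"
      using r unfolding quasimode_def by (smt (verit) mult_right_mono zero_less_power)
    then have "ereal (\<delta> * \<xi> / (real (n * N) * ((\<bar>C\<bar> + 1) * r ^ n))) \<le> condition_number (block_toeplitz N n a)"
      unfolding \<delta>_def using \<xi> entry True by (intro condition_number_ge_quasimode) (auto simp: n1_def)
    moreover have "c * exp (\<alpha> * real n) \<le> \<delta> * \<xi> / (real (n * N) * ((\<bar>C\<bar> + 1) * r ^ n))"
    proof -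
      have "real (n * N) * ((\<bar>C\<bar> + 1) * r ^ n) = real N * (\<bar>C\<bar> + 1) * (real n * \<rho> ^ n) * \<rho> ^ n"
        by (simp add: \<rho>(3) power_mult_distrib)
      also have "\<dots> \<le> L * \<rho> ^ n" unfolding L_def
        using K(2)[of n] \<rho> by (intro mult_right_mono mult_left_mono) auto
      finally have *: "real (n * N) * ((\<bar>C\<bar> + 1) * r ^ n) \<le> L * \<rho> ^ n" .
      have "c * exp (\<alpha> * real n) \<le> (\<delta> * \<xi> / L) * exp (\<alpha> * real n)"
        by (intro mult_right_mono) (auto simp: c_def)
      also have "\<dots> = \<delta> * \<xi> / (L * \<rho> ^ n)" by (simp add: exp_\<alpha>)
      also have "\<dots> \<le> \<delta> * \<xi> / (real (n * N) * ((\<bar>C\<bar> + 1) * r ^ n))"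
        using * \<delta> \<xi> r n entry L \<rho> by (intro divide_left_mono mult_pos_pos) (auto intro!: mult_pos_pos)
      finally show ?thesis .
    qed
    ultimately show ?thesis by (meson ereal_less_eq(3) order_trans)
  next
    case False
    have "c * exp (\<alpha> * real n) \<le> exp (- (\<alpha> * real n1)) * exp (\<alpha> * real n1)"
      using False \<alpha> c by (intro mult_mono) (auto simp: c_def)
    also have "\<dots> = 1" by (simp add: exp_minus)
    finally have "ereal (c * exp (\<alpha> * real n)) \<le> 1" by simp
    also have "1 \<le> condition_number (block_toeplitz N n a)"
      using n entry by (intro one_le_condition_number[of _ "n * N"]) (auto simp: block_toeplitz_def)
    finally show ?thesis .
  qed
  with c \<alpha> show ?thesis by blast
qed

section \<open>Exponential growth of the condition number\<close>

theorem theorem4p1: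
  fixes N k m s l :: nat and M :: "int \<Rightarrow> complex mat"
  assumes "N \<ge> 1"
    and "\<And>j. - int k \<le> j \<Longrightarrow> j \<le> int m \<Longrightarrow> M j \<in> carrier_mat N N"
    and "matrix_poly_type (matrix_poly N k m M) s 0 l"
    and "s \<noteq> k * N"
  shows "\<exists>c \<alpha> :: real. c > 0 \<and> \<alpha> > 0 \<and>
    (\<forall>n::nat. n \<ge> 1 \<longrightarrow>
      ereal (c * exp (\<alpha> * real n)) \<le> condition_number (block_toeplitz N n (band_coeff N k m M)))"
proof -
  let ?S = "matrix_poly N k m M"
  have "\<exists>p<N. \<exists>q<N. ?S $$ (p, q) \<noteq> 0"
  proof (rule ccontr)
    assume "\<not> ?thesis"
    then have "?S = 0\<^sub>m N N" by (intro eq_matI) (auto simp: matrix_poly_def)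
    then have "det ?S = 0" using assms(1) det_zero[of N] by simp
    with assms(3) show False by (simp add: matrix_poly_type_def)
  qed
  then obtain p q e where pq: "p < N" "q < N" and "Polynomial.coeff (?S $$ (p, q)) e \<noteq> 0"
    by (metis leading_coeff_0_iff)
  then have "band_coeff N k m M (int e - int k) $$ (p, q) \<noteq> 0"
    by (simp add: coeff_matrix_poly)
  with pq quasimodes_if_nonzero_index[OF assms(3,4)] show ?thesis
    by (intro condition_number_exponential)
qed

end
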